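(* Let $\mathcal{E}:\mathbb{M}_2\to\mathbb{M}_2$ be a unital quantum channel, and let $T$ be the real $3\times 3$ matrix induced by $\mathcal{E}$ via $$\mathcal{E}\left(\tfrac12\left[I_2+\vec r\cdot\vec\sigma\right]\right)=\tfrac12\left[I_2+(T\vec r)\cdot\vec\sigma\right]\qquad\text{for all } \vec r\in\mathbb{R}^3,\ \|\vec r\|\le 1.$$ Let $\mathcal{S}$ be the set of all pure states (unit vectors) $|\phi\rangle\in\mathbb{C}^2$ with $\mathcal{E}(|\phi\rangle\langle\phi|)=\frac12 I_2$, that is, the full set of private states for which $[\mathcal{S},\mathcal{E},\frac12 I_2]$ is a private quantum channel, and suppose that $\mathcal{S}$ is nonempty. Then there are three possibilities (the nullspace of $T$ has dimension $1$, $2$ or $3$): 1. If the nullspace of $T$ is $1$-dimensional, then $\mathcal{S}$ consists of a pair of orthonormal states (vectors being identified when they differ by a complex phase). 2. If the nullspace of $T$ is $2$-dimensional, then there is a unitary $U\in\mathbb{M}_2$ such that $\mathcal{S}$ is the set of all trace vectors of the subalgebra $U^\dagger\Delta_2U$, where $\Delta_2$ is the algebra of diagonal $2\times 2$ matrices. 3. If the nullspace of $T$ is $3$-dimensional, then $\mathcal{E}$ is the completely depolarizing channel and $\mathcal{S}$ is the set of all unit vectors in $\mathbb{C}^2$; in other words, $\mathcal{S}$ is the set of all trace vectors of $\mathbb{C}\cdot I_2$.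
   Context: $\mathbb{M}_2$ is the algebra of complex $2\times2$ matrices, with identity $I_2$. A quantum channel is a linear, completely positive, trace preserving map; it is unital if it maps the identity to the identity. A density operator is a positive semidefinite operator of trace $1$. A pure state is represented by a unit vector $|\phi\rangle$, equivalently by the rank-one projection $|\phi\rangle\langle\phi|$, so unit vectors differing by a complex phase represent the same state. Private quantum channel: for a set $\mathcal{S}$ of pure states in a finite-dimensional Hilbert space $\mathcal{H}$, a channel $\mathcal{E}:\mathcal{L}(\mathcal{H})\to\mathcal{L}(\mathcal{H})$ and a density operator $\rho_0$ on $\mathcal{H}$, the triple $[\mathcal{S},\mathcal{E},\rho_0]$ is a private quantum channel if $\mathcal{E}(|\phi\rangle\langle\phi|)=\rho_0$ for every $|\phi\rangle\in\mathcal{S}$. Bloch representation: $\vec\sigma=(\sigma_x,\sigma_y,\sigma_z)^T$ is the vector of Pauli matrices and $\vec r\cdot\vec\sigma=r_x\sigma_x+r_y\sigma_y+r_z\sigma_z$. Every density matrix in $\mathbb{M}_2$ is uniquely of the form $\frac12(I_2+\vec r\cdot\vec\sigma)$ with $\vec r\in\mathbb{R}^3$, $\|\vec r\|\le1$, and it is pure if and only if $\|\vec r\|=1$. Every unital channel on $\mathbb{M}_2$ is described by a unique real $3\times3$ matrix $T$ as in the displayed formula of the claim. Trace vector: for a $*$-subalgebra $\mathcal{A}\subseteq\mathbb{M}_n$, a vector $|v\rangle\in\mathbb{C}^n$ is a trace vector of $\mathcal{A}$ if $\langle v|a|v\rangle=\frac1n\operatorname{Tr}(a)$ for all $a\in\mathcal{A}$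 (here $n=2$). The completely depolarizing channel on $\mathbb{M}_2$ is the channel sending every density matrix to $\frac12 I_2$, i.e. $X\mapsto\frac{\operatorname{Tr}(X)}{2}I_2$. *)

theory Defs
  imports "HOL-Analysis.Analysis"
begin

text \<open>Vectors of \<open>\<complex>\<^sup>n\<close> have type \<^typ>\<open>complex^'n\<close>; the complex scalar
  multiple of a vector is the library's \<open>c *s v\<close>. The library's \<open>c *\<^sub>R A\<close> only takes real \<open>c\<close>, and
  \<open>*s\<close> on matrices would take a row vector as scalar, hence:\<close>

definition mscale :: "complex \<Rightarrow> complex^'n^'m \<Rightarrow> complex^'n^'m"  (infixr \<open>*\<^sub>m\<close> 75)
  where "c *\<^sub>m A = (\<chi> i j. c * A $ i $ j)"

lemma vector_space_mscale: "vector_space (mscale :: _ \<Rightarrow> complex^'n^'m \<Rightarrow> _)"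
  by unfold_locales (simp_all add: mscale_def vec_eq_iff algebra_simps)

lemma matrix_mult_mscale: "X ** (c *\<^sub>m Y) = c *\<^sub>m (X ** Y)"
  and mscale_matrix_mult: "(c *\<^sub>m X) ** Y = c *\<^sub>m (X ** Y)"
  by (simp_all add: mscale_def matrix_matrix_mult_def vec_eq_iff sum_distrib_left mult_ac)

definition cinner :: "complex^'n \<Rightarrow> complex^'n \<Rightarrow> complex"
  where "cinner v w = (\<Sum>i\<in>UNIV. cnj (v $ i) * w $ i)"

definition dagger :: "complex^'n^'m \<Rightarrow> complex^'m^'n"
  where "dagger A = (\<chi> i j. cnj (A $ j $ i))"

definition unitary :: "complex^'n^'n \<Rightarrow> bool"
  where "unitary U \<longleftrightarrow> dagger U ** U = mat 1 \<and> U ** dagger U = mat 1"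

definition ketbra :: "complex^'n \<Rightarrow> complex^'n^'n"
  where "ketbra v = (\<chi> i j. v $ i * cnj (v $ j))"

definition pure_state :: "complex^'n \<Rightarrow> bool"
  where "pure_state v \<longleftrightarrow> norm v = 1"

definition psd :: "complex^'n^'n \<Rightarrow> bool"
  where "psd A \<longleftrightarrow> (\<forall>x. cinner x (A *v x) \<in> \<real>\<^sub>\<ge>\<^sub>0)"

definition density_operator :: "complex^'n^'n \<Rightarrow> bool"
  where "density_operator \<rho> \<longleftrightarrow> psd \<rho> \<and> trace \<rho> = 1"

text \<open>An element of \<open>M\<^sub>k(M\<^sub>n)\<close> is given by its blocks \<open>A i j\<close> with \<open>i, j < k\<close>, a vector
  of \<open>\<complex>\<^sup>k \<otimes> \<complex>\<^sup>n\<close> by its components \<open>x i\<close> with \<open>i < k\<close>. Under this identification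
  \<open>id\<^sub>k \<otimes> \<Phi>\<close> applies \<open>\<Phi>\<close> to every block.\<close>

definition block_psd :: "nat \<Rightarrow> (nat \<Rightarrow> nat \<Rightarrow> complex^'n^'n) \<Rightarrow> bool"
  where "block_psd k A \<longleftrightarrow>
    (\<forall>x :: nat \<Rightarrow> complex^'n. (\<Sum>i<k. \<Sum>j<k. cinner (x i) (A i j *v x j)) \<in> \<real>\<^sub>\<ge>\<^sub>0)"

definition completely_positive :: "(complex^'n^'n \<Rightarrow> complex^'m^'m) \<Rightarrow> bool"
  where "completely_positive \<Phi> \<longleftrightarrow>
    (\<forall>k A. block_psd k A \<longrightarrow> block_psd k (\<lambda>i j. \<Phi> (A i j)))"

definition quantum_channel :: "(complex^'n^'n \<Rightarrow> complex^'m^'m) \<Rightarrow> bool"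
  where "quantum_channel \<Phi> \<longleftrightarrow>
    Vector_Spaces.linear mscale mscale \<Phi> \<and> completely_positive \<Phi> \<and> (\<forall>X. trace (\<Phi> X) = trace X)"

definition unital :: "(complex^'n^'n \<Rightarrow> complex^'m^'m) \<Rightarrow> bool"
  where "unital \<Phi> \<longleftrightarrow> \<Phi> (mat 1) = mat 1"

definition private_quantum_channel ::
    "(complex^'n) set \<Rightarrow> (complex^'n^'n \<Rightarrow> complex^'n^'n) \<Rightarrow> complex^'n^'n \<Rightarrow> bool"
  where "private_quantum_channel S \<Phi> \<rho>\<^sub>0 \<longleftrightarrow>
    (\<forall>\<phi>\<in>S. pure_state \<phi>) \<and> quantum_channel \<Phi> \<and> density_operator \<rho>\<^sub>0 \<and>
    (\<forall>\<phi>\<in>S. \<Phi> (ketbra \<phi>) = \<rho>\<^sub>0)"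

definition private_states ::
    "(complex^'n^'n \<Rightarrow> complex^'n^'n) \<Rightarrow> complex^'n^'n \<Rightarrow> (complex^'n) set"
  where "private_states \<Phi> \<rho>\<^sub>0 = {\<phi>. pure_state \<phi> \<and> \<Phi> (ketbra \<phi>) = \<rho>\<^sub>0}"

lemma private_quantum_channel_iff:
  assumes "quantum_channel \<Phi>" "density_operator \<rho>\<^sub>0"
  shows "private_quantum_channel S \<Phi> \<rho>\<^sub>0 \<longleftrightarrow> S \<subseteq> private_states \<Phi> \<rho>\<^sub>0"
  using assms unfolding private_quantum_channel_def private_states_def by auto

lemma density_operator_maximally_mixed: "density_operator ((1/2) *\<^sub>m mat 1 :: complex^2^2)"
proof -
  have "cinner x (((1/2) *\<^sub>m mat 1) *v x) = complex_of_real (((norm (x $ 1))\<^sup>2 + (norm (x $ 2))\<^sup>2) / 2)"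
    for x :: "complex^2"
    by (simp add: cinner_def mscale_def mat_def matrix_vector_mult_def sum_2 complex_norm_square
        algebra_simps add_divide_distrib del: of_real_power)
  moreover have "trace ((1/2) *\<^sub>m mat 1 :: complex^2^2) = 1"
    by (simp add: trace_def mscale_def mat_def sum_2)
  ultimately show ?thesis
    by (simp add: density_operator_def psd_def nonneg_Reals_of_real_iff del: of_real_add of_real_divide)
qed

definition pauli_x :: "complex^2^2"
  where "pauli_x = vector [vector [0, 1], vector [1, 0]]"

definition pauli_y :: "complex^2^2"
  where "pauli_y = vector [vector [0, - \<i>], vector [\<i>, 0]]"

definition pauli_z :: "complex^2^2"
  where "pauli_z = vector [vector [1, 0], vector [0, - 1]]"

definition dot_sigma :: "real^3 \<Rightarrow> complex^2^2"
  where "dot_sigma r = complex_of_real (r $ 1) *\<^sub>m pauli_x + complex_of_real (r $ 2) *\<^sub>m pauli_y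
    + complex_of_real (r $ 3) *\<^sub>m pauli_z"

definition bloch :: "real^3 \<Rightarrow> complex^2^2"
  where "bloch r = (1/2) *\<^sub>m (mat 1 + dot_sigma r)"

definition star_subalgebra :: "(complex^'n^'n) set \<Rightarrow> bool"
  where "star_subalgebra A \<longleftrightarrow> 0 \<in> A \<and> (\<forall>a\<in>A. \<forall>b\<in>A. a + b \<in> A) \<and> (\<forall>c. \<forall>a\<in>A. c *\<^sub>m a \<in> A) \<and>
    (\<forall>a\<in>A. \<forall>b\<in>A. a ** b \<in> A) \<and> (\<forall>a\<in>A. dagger a \<in> A)"

definition trace_vector :: "(complex^'n^'n) set \<Rightarrow> complex^'n \<Rightarrow> bool"
  where "trace_vector A v \<longleftrightarrow> star_subalgebra A \<and>
    (\<forall>a\<in>A. cinner v (a *v v) = (1 / of_nat CARD('n)) * trace a)"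

definition diagonal_matrices :: "(complex^'n^'n) set"
  where "diagonal_matrices = {D. \<forall>i j. i \<noteq> j \<longrightarrow> D $ i $ j = 0}"

definition scalar_matrices :: "(complex^'n^'n) set"
  where "scalar_matrices = range (\<lambda>c. c *\<^sub>m mat 1)"

lemma star_subalgebra_scalar_matrices: "star_subalgebra (scalar_matrices :: (complex^'n^'n) set)"
proof -
  have "0 = 0 *\<^sub>m (mat 1 :: complex^'n^'n)"
    and "a *\<^sub>m mat 1 + b *\<^sub>m mat 1 = (a + b) *\<^sub>m (mat 1 :: complex^'n^'n)"
    and "c *\<^sub>m a *\<^sub>m mat 1 = (c * a) *\<^sub>m (mat 1 :: complex^'n^'n)"
    and "(a *\<^sub>m mat 1) ** (b *\<^sub>m mat 1) = (a * b) *\<^sub>m (mat 1 :: complex^'n^'n)"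
    and "dagger (a *\<^sub>m mat 1) = cnj a *\<^sub>m (mat 1 :: complex^'n^'n)" for a b c
    by (simp_all add: matrix_mult_mscale mscale_matrix_mult)
      (auto simp: vec_eq_iff mscale_def mat_def dagger_def distrib_right)
  then show ?thesis
    unfolding star_subalgebra_def scalar_matrices_def by auto
qed

lemma star_subalgebra_diagonal_matrices:
  "star_subalgebra (diagonal_matrices :: (complex^'n^'n) set)"
proof -
  have "(\<Sum>k\<in>UNIV. a $ i $ k * b $ k $ j) = 0"
    if "\<forall>i j. i \<noteq> j \<longrightarrow> a $ i $ j = 0" "\<forall>i j. i \<noteq> j \<longrightarrow> b $ i $ j = 0" "i \<noteq> j"
    for a b :: "complex^'n^'n" and i j
    using that by (intro sum.neutral) (metis mult_eq_0_iff)
  then show ?thesis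
    unfolding star_subalgebra_def diagonal_matrices_def
    by (auto simp: mscale_def dagger_def matrix_matrix_mult_def)
qed

lemma star_subalgebra_conjugate:
  fixes A :: "(complex^'n^'n) set"
  assumes "star_subalgebra A" "unitary U"
  shows "star_subalgebra {dagger U ** D ** U | D. D \<in> A}"
proof -
  have dm: "dagger (X ** Y) = dagger Y ** dagger X" for X Y :: "complex^'n^'n"
    by (simp add: dagger_def matrix_matrix_mult_def vec_eq_iff mult.commute)
  have dd: "dagger (dagger X) = X" for X :: "complex^'n^'n"
    by (simp add: dagger_def vec_eq_iff)
  have z: "X ** 0 = 0" "0 ** X = 0" for X :: "complex^'n^'n"
    by (simp_all add: matrix_matrix_mult_def vec_eq_iff)
  let ?c = "\<lambda>D. dagger U ** D ** U"
  have zero: "?c 0 = 0" by (simp add: z)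
  have add: "?c D + ?c E = ?c (D + E)" for D E
    by (simp add: matrix_add_ldistrib)
      (simp add: matrix_matrix_mult_def vec_eq_iff sum.distrib distrib_right)
  have scale: "c *\<^sub>m ?c D = ?c (c *\<^sub>m D)" for c D
    by (simp add: matrix_mult_mscale mscale_matrix_mult)
  have mult: "?c D ** ?c E = ?c (D ** E)" for D E
  proof -
    have "?c D ** ?c E = dagger U ** D ** (U ** dagger U) ** E ** U"
      by (simp add: matrix_mul_assoc)
    with assms(2) show ?thesis by (simp add: unitary_def matrix_mul_assoc)
  qed
  have dagger: "dagger (?c D) = ?c (dagger D)" for D
    by (simp add: dm dd matrix_mul_assoc)
  have "star_subalgebra (?c ` A)"
    using assms(1) unfolding star_subalgebra_def ball_simps add scale mult dagger
    by (auto intro!: image_eqI[where x = 0] simp: zero)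
  moreover have "{?c D | D. D \<in> A} = ?c ` A" by auto
  ultimately show ?thesis by simp
qed

definition completely_depolarizing :: "complex^2^2 \<Rightarrow> complex^2^2"
  where "completely_depolarizing X = (trace X / 2) *\<^sub>m mat 1"

end

theory Submission
  imports Defs
begin

text \<open>
  The Hopf map \<open>v \<mapsto> r\<close> with \<open>|v\<rangle>\<langle>v| = \<onehalf>(I + r \<cdot> \<sigma>)\<close> sends the unit vectors of \<open>\<complex>\<^sup>2\<close> onto the unit sphere
  of \<open>\<real>\<^sup>3\<close>, its fibres are the phase orbits, and \<open>2 |\<langle>v|w\<rangle>|\<^sup>2 = \<parallel>v\<parallel>\<^sup>2 \<parallel>w\<parallel>\<^sup>2 + r\<^sub>v \<bullet> r\<^sub>w\<close>. Hence the private
  states are the preimage of the unit sphere of the nullspace of \<open>T\<close>: an antipodal pair, a great circle or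
  the whole sphere. Antipodal points correspond to orthonormal vectors. If the circle is orthogonal to the
  Bloch vectors \<open>\<plusminus>n\<close> of an orthonormal basis, then it consists of the vectors that are unbiased
  with respect to that basis, and these are the trace vectors of the matrices diagonal in the basis.
\<close>

section \<open>Unit vectors and their Bloch vectors\<close>

lemma norm_complex2: "(norm (v :: complex^2))\<^sup>2 = (cmod (v $ 1))\<^sup>2 + (cmod (v $ 2))\<^sup>2"
  by (simp add: norm_vec_def L2_set_def sum_2)

lemma pure_state_iff: "pure_state (v :: complex^2) \<longleftrightarrow> (norm v)\<^sup>2 = 1"
  by (simp add: pure_state_def power2_eq_1_iff) (smt (verit) norm_ge_zero)

lemma cinner_self: "cinner (v :: complex^2) v = of_real ((norm v)\<^sup>2)"
  by (simp add: cinner_def sum_2 norm_complex2 complex_norm_square mult.commute del: of_real_power)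

text \<open>The components are the expectation values of the three Pauli matrices in
  \<open>v\<close>. The formula is quadratic in \<open>v\<close> and makes sense without
  normalisation.\<close>

definition bloch_vector :: "complex^2 \<Rightarrow> real^3"
  where "bloch_vector v = vector [2 * Re (cnj (v $ 1) * v $ 2), 2 * Im (cnj (v $ 1) * v $ 2),
    (cmod (v $ 1))\<^sup>2 - (cmod (v $ 2))\<^sup>2]"

lemma bloch_nth:
  "bloch r $ 1 $ 1 = of_real ((1 + r $ 3) / 2)"
  "bloch r $ 1 $ 2 = Complex (r $ 1 / 2) (- (r $ 2 / 2))"
  "bloch r $ 2 $ 1 = Complex (r $ 1 / 2) (r $ 2 / 2)"
  "bloch r $ 2 $ 2 = of_real ((1 - r $ 3) / 2)"
  by (simp_all add: bloch_def dot_sigma_def pauli_x_def pauli_y_def pauli_z_def mscale_def mat_def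
      complex_eq_iff)

lemma bloch_eq_iff: "bloch r = bloch s \<longleftrightarrow> r = s"
  by (auto simp: vec_eq_iff[of "bloch r"] vec_eq_iff[of "bloch r $ _"] vec_eq_iff[of r]
      forall_2 forall_3 bloch_nth)

lemma bloch_0: "bloch 0 = (1/2) *\<^sub>m mat 1"
  by (simp add: bloch_def dot_sigma_def vec_eq_iff mscale_def)

lemma ketbra_eq_bloch:
  assumes "pure_state v"
  shows "ketbra v = bloch (bloch_vector v)"
proof -
  have "(Re (v $ 1))\<^sup>2 + (Im (v $ 1))\<^sup>2 + ((Re (v $ 2))\<^sup>2 + (Im (v $ 2))\<^sup>2) = 1"
    using assms by (simp add: pure_state_iff norm_complex2 cmod_power2)
  then show ?thesis
    by (simp add: vec_eq_iff forall_2 bloch_nth ketbra_def bloch_vector_def complex_eq_iff cmod_power2)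
      (simp add: power2_eq_square field_simps)
qed

text \<open>This is a polynomial identity in the eight real coordinates of \<open>v\<close> and
  \<open>w\<close>. Leaving both unnormalised lets it later prove that a vector has norm 1 instead
  of presupposing it.\<close>

lemma norm_cinner_eq_bloch_vector:
  "2 * (cmod (cinner v w))\<^sup>2 = (norm v)\<^sup>2 * (norm w)\<^sup>2 + bloch_vector v \<bullet> bloch_vector w"
  by (simp add: norm_complex2 cinner_def sum_2 bloch_vector_def inner_vec_def sum_3 cmod_power2) algebra

lemma norm_bloch_vector: "norm (bloch_vector v) = (norm v)\<^sup>2"
proof -
  have "(norm (bloch_vector v))\<^sup>2 = ((norm v)\<^sup>2)\<^sup>2"
    using norm_cinner_eq_bloch_vector[of v v]
    by (simp add: cinner_self dot_square_norm norm_power flip: power2_eq_square)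
  then show ?thesis by (simp only: power2_eq_iff_nonneg norm_ge_zero zero_le_power2)
qed

lemma bloch_vector_phase:
  assumes "cmod c = 1"
  shows "bloch_vector (c *s v) = bloch_vector v"
proof -
  have "cnj c * c = 1"
    using assms complex_norm_square[of c] by (simp add: mult.commute)
  then have "cnj (c * a) * (c * b) = cnj a * b" for a b
    by (simp add: algebra_simps)
  then show ?thesis
    unfolding bloch_vector_def vector_smult_component by (simp only:) (simp add: assms norm_mult)
qed

lemma pure_state_phase:
  assumes "cmod c = 1" "pure_state (v :: complex^2)"
  shows "pure_state (c *s v)"
  using assms by (simp add: pure_state_iff norm_complex2 norm_mult power_mult_distrib)

text \<open>An explicit preimage is built whose first component is a positive real. Only at the
  south pole must the first component vanish, so that point is treated separately.\<close>

lemma bloch_vector_surj: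
  assumes "norm (r :: real^3) = 1"
  obtains v where "pure_state v" "bloch_vector v = r"
proof (cases "r $ 3 = -1")
  case True
  have r: "(r $ 1)\<^sup>2 + (r $ 2)\<^sup>2 + (r $ 3)\<^sup>2 = 1"
    using assms by (simp add: norm_vec_def L2_set_def sum_3)
  with True have "r $ 1 = 0" "r $ 2 = 0"
    by (simp_all add: sum_power2_eq_zero_iff)
  with True show ?thesis
    by (intro that[of "vector [0, 1]"])
      (simp_all add: pure_state_iff norm_complex2 bloch_vector_def vec_eq_iff forall_3)
next
  case False
  have r: "(r $ 1)\<^sup>2 + (r $ 2)\<^sup>2 + (r $ 3)\<^sup>2 = 1"
    using assms by (simp add: norm_vec_def L2_set_def sum_3)
  have "\<bar>r $ 3\<bar> \<le> 1"
    using component_le_norm_cart[of r 3] assms by simp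
  with False have pos: "1 + r $ 3 > 0" by simp
  \<comment> \<open>The norm and the third Bloch component force \<open>a\<^sup>2\<close> to be the
    squared modulus of the first component. The second component then solves
    \<open>a * v $ 2 = (r $ 1 + \<i> * r $ 2) / 2\<close>.\<close>
  define a where "a = sqrt ((1 + r $ 3) / 2)"
  have a: "a > 0" "a\<^sup>2 = (1 + r $ 3) / 2"
    using pos by (simp_all add: a_def)
  define v where "v = (vector [of_real a, Complex (r $ 1 / (2 * a)) (r $ 2 / (2 * a))] :: complex^2)"
  have "(cmod (v $ 2))\<^sup>2 = ((r $ 1)\<^sup>2 + (r $ 2)\<^sup>2) / (4 * a\<^sup>2)"
    by (simp add: v_def cmod_power2 power_divide power_mult_distrib add_divide_distrib)
  also have "\<dots> = (1 - r $ 3) * (1 + r $ 3) / (4 * a\<^sup>2)"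
    using r by (simp add: algebra_simps power2_eq_square)
  also have "\<dots> = (1 - r $ 3) / 2"
    using pos by (simp add: a(2) divide_simps)
  finally have "(cmod (v $ 2))\<^sup>2 = (1 - r $ 3) / 2" .
  moreover have "(cmod (v $ 1))\<^sup>2 = (1 + r $ 3) / 2"
    using a by (simp add: v_def)
  moreover have "Re (cnj (v $ 1) * v $ 2) = r $ 1 / 2" "Im (cnj (v $ 1) * v $ 2) = r $ 2 / 2"
    using a(1) by (simp_all add: v_def)
  ultimately show ?thesis
    by (intro that[of v])
      (simp_all only: pure_state_iff norm_complex2 bloch_vector_def vec_eq_iff forall_3 vector_3,
        simp_all add: field_simps)
qed

lemma bloch_vector_eq_iff:
  assumes "pure_state v" "pure_state w"
  shows "bloch_vector w = bloch_vector v \<longleftrightarrow> (\<exists>c. cmod c = 1 \<and> w = c *s v)"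
proof
  assume eq: "bloch_vector w = bloch_vector v"
  then have "ketbra w = ketbra v"
    using assms by (simp add: ketbra_eq_bloch)
  \<comment> \<open>Applying the two equal projections to \<open>w\<close> exhibits \<open>w\<close>
    as a multiple of \<open>v\<close>; the required phase is \<open>cinner v w\<close>.\<close>
  moreover have "ketbra u *v w = cinner u w *s u" for u
    by (simp add: vec_eq_iff ketbra_def matrix_vector_mult_def cinner_def sum_2 algebra_simps)
  ultimately have "cinner w w *s w = cinner v w *s v" by metis
  then have "w = cinner v w *s v"
    using assms(2) by (simp add: cinner_self pure_state_def)
  moreover have "(cmod (cinner v w))\<^sup>2 = 1"
    using norm_cinner_eq_bloch_vector[of v w] assms eq
    by (simp add: pure_state_def dot_square_norm norm_bloch_vector)
  then have "cmod (cinner v w) = 1"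
    by (simp add: power2_eq_1_iff) (smt (verit) norm_ge_zero)
  ultimately show "\<exists>c. cmod c = 1 \<and> w = c *s v" by blast
next
  assume "\<exists>c. cmod c = 1 \<and> w = c *s v"
  then show "bloch_vector w = bloch_vector v"
    by (auto simp: bloch_vector_phase)
qed

text \<open>In the overlap identity the product of the norms contributes 1 and the antipodal Bloch
  vectors contribute -1.\<close>

lemma cinner_antipodal:
  assumes "pure_state v" "pure_state w" "bloch_vector w = - bloch_vector v"
  shows "cinner v w = 0"
  using norm_cinner_eq_bloch_vector[of v w] assms
  by (simp add: pure_state_def dot_square_norm norm_bloch_vector)

section \<open>Trace vectors of the scalar and of the conjugated diagonal matrices\<close>

lemma trace_vector_scalar_matrices:
  "trace_vector scalar_matrices (v :: complex^2) \<longleftrightarrow> pure_state v"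
proof -
  have "cinner v ((c *\<^sub>m mat 1) *v v) = c * of_real ((norm v)\<^sup>2)" for c
  proof -
    have "cinner v ((c *\<^sub>m mat 1) *v v) = c * cinner v v"
      by (simp add: cinner_def mscale_def mat_def matrix_vector_mult_def sum_2 algebra_simps)
    then show ?thesis by (simp only: cinner_self)
  qed
  moreover have "trace (c *\<^sub>m mat 1 :: complex^2^2) = 2 * c" for c
    by (simp add: trace_def mscale_def mat_def sum_2)
  ultimately show ?thesis
    \<comment> \<open>The trace condition for the scalar \<open>c\<close> reads
      \<open>c * (norm v)\<^sup>2 = c\<close>; the instance \<open>c = 1\<close> already forces norm
      1.\<close>
    by (auto simp: trace_vector_def scalar_matrices_def pure_state_iff
        star_subalgebra_scalar_matrices[unfolded scalar_matrices_def] simp del: of_real_power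
        dest: spec[of _ 1])
qed

text \<open>Moving \<open>U\<close> onto the vector turns the expectation into a sum of the diagonal
  entries weighted by the squared moduli of \<open>U *v v\<close>, while the trace is unchanged by
  conjugation. Equality for all diagonal matrices means that both weights are 1/2.\<close>

lemma trace_vector_conjugate_diagonal:
  fixes U :: "complex^2^2"
  assumes U: "unitary U"
  shows "trace_vector {dagger U ** D ** U | D. D \<in> diagonal_matrices} v \<longleftrightarrow>
    (\<forall>i. (cmod ((U *v v) $ i))\<^sup>2 = 1/2)"
proof -
  let ?w = "U *v v"
  have expect: "cinner v ((dagger U ** D ** U) *v v) =
      D $ 1 $ 1 * of_real ((cmod (?w $ 1))\<^sup>2) + D $ 2 $ 2 * of_real ((cmod (?w $ 2))\<^sup>2)"
    if "D \<in> diagonal_matrices" for D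
  proof -
    have "cinner v (dagger U *v x) = cinner ?w x" for x
      by (simp add: cinner_def dagger_def matrix_vector_mult_def sum_2 algebra_simps)
    then have "cinner v ((dagger U ** D ** U) *v v) = cinner ?w (D *v ?w)"
      by (simp add: matrix_vector_mul_assoc[symmetric])
    also have "\<dots> = D $ 1 $ 1 * (cnj (?w $ 1) * ?w $ 1) + D $ 2 $ 2 * (cnj (?w $ 2) * ?w $ 2)"
      using that by (simp add: cinner_def matrix_vector_mult_def[of D] sum_2 diagonal_matrices_def)
    finally show ?thesis
      by (simp add: complex_norm_square mult.commute del: of_real_power)
  qed
  have tr: "trace (dagger U ** D ** U) = D $ 1 $ 1 + D $ 2 $ 2" for D
  proof -
    have "trace (dagger U ** D ** U) = trace (U ** (dagger U ** D))"
      by (rule trace_mul_sym)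
    also have "\<dots> = trace D"
      using U by (simp add: matrix_mul_assoc unitary_def)
    finally show ?thesis by (simp add: trace_def sum_2)
  qed
  define p where "p i = (cmod (?w $ i))\<^sup>2" for i
  have "trace_vector {dagger U ** D ** U | D. D \<in> diagonal_matrices} v \<longleftrightarrow>
    (\<forall>D\<in>(diagonal_matrices :: (complex^2^2) set). D $ 1 $ 1 * of_real (p 1) + D $ 2 $ 2 * of_real (p 2)
      = (D $ 1 $ 1 + D $ 2 $ 2) / 2)"
    using star_subalgebra_conjugate[OF star_subalgebra_diagonal_matrices U] expect
    unfolding trace_vector_def by (fastforce simp: tr p_def)
  also have "\<dots> \<longleftrightarrow> p 1 = 1/2 \<and> p 2 = 1/2" (is "?L \<longleftrightarrow> ?R")
  proof
    assume L: ?L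
    \<comment> \<open>The two diagonal matrix units isolate one weight each.\<close>
    have "vector [vector [1, 0], vector [0, 0]] \<in> (diagonal_matrices :: (complex^2^2) set)"
      "vector [vector [0, 0], vector [0, 1]] \<in> (diagonal_matrices :: (complex^2^2) set)"
      by (simp_all add: diagonal_matrices_def forall_2)
    from L[rule_format, OF this(1)] L[rule_format, OF this(2)]
    have "complex_of_real (p 1) = of_real (1/2)" "complex_of_real (p 2) = of_real (1/2)" by simp_all
    then show ?R unfolding of_real_eq_iff by simp
  next
    assume ?R
    then have "complex_of_real (p 1) = of_real (1/2)" "complex_of_real (p 2) = of_real (1/2)"
      by (simp_all only:)
    then show ?L by (simp only:) (simp add: add_divide_distrib)
  qed
  finally show ?thesis by (simp add: forall_2 p_def)
qed

lemma trace_vectors_great_circle: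
  fixes n :: "real^3"
  assumes "norm n = 1"
  obtains U :: "complex^2^2" where "unitary U"
    "\<And>v. trace_vector {dagger U ** D ** U | D. D \<in> diagonal_matrices} v \<longleftrightarrow>
      pure_state v \<and> n \<bullet> bloch_vector v = 0"
proof -
  obtain \<phi> where \<phi>: "pure_state \<phi>" "bloch_vector \<phi> = n"
    using bloch_vector_surj[OF assms] by blast
  obtain \<psi> where \<psi>: "pure_state \<psi>" "bloch_vector \<psi> = - n"
    using bloch_vector_surj[of "- n"] assms by auto
  have orth: "cinner \<phi> \<psi> = 0" "cinner \<psi> \<phi> = 0"
    using \<phi> \<psi> by (simp_all add: cinner_antipodal)
  have unit: "cinner \<phi> \<phi> = 1" "cinner \<psi> \<psi> = 1"
    using \<phi> \<psi> by (simp_all add: cinner_self pure_state_iff del: of_real_power)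
  \<comment> \<open>The rows are the bras of the basis, so that \<open>U *v v\<close> lists the
    coordinates of \<open>v\<close> in it.\<close>
  define U where "U = (\<chi> i j. if i = 1 then cnj (\<phi> $ j) else cnj (\<psi> $ j) :: complex^2^2)"
  have Uv: "(U *v v) $ 1 = cinner \<phi> v" "(U *v v) $ 2 = cinner \<psi> v" for v
    by (simp_all add: U_def matrix_vector_mult_def cinner_def)
  have "U ** dagger U = mat 1"
    using orth unit
    by (simp add: U_def dagger_def matrix_matrix_mult_def vec_eq_iff forall_2 mat_def cinner_def)
  then have "unitary U"
    by (simp add: unitary_def matrix_left_right_inverse)
  \<comment> \<open>The overlap identity gives twice the weights as \<open>(norm v)\<^sup>2\<close>
    plus and minus \<open>n \<bullet> bloch_vector v\<close>. Both equal 1 exactly when the norm is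
    1 and the inner product is 0.\<close>
  moreover have "(\<forall>i. (cmod ((U *v v) $ i))\<^sup>2 = 1/2) \<longleftrightarrow> pure_state v \<and> n \<bullet> bloch_vector v = 0" for v
    using norm_cinner_eq_bloch_vector[of \<phi> v] norm_cinner_eq_bloch_vector[of \<psi> v] \<phi> \<psi>
    by (auto simp: forall_2 Uv pure_state_iff)
  ultimately show ?thesis
    by (intro that) (auto simp: trace_vector_conjugate_diagonal)
qed

text \<open>Four density matrices from the Bloch ball span all matrices over the complex numbers, so
  linearity extends the hypothesis from the ball to every \<open>X\<close>.\<close>

lemma channel_eq_depolarizing:
  assumes lin: "Vector_Spaces.linear mscale mscale (\<E> :: complex^2^2 \<Rightarrow> complex^2^2)"
    and half: "\<And>r. norm r \<le> 1 \<Longrightarrow> \<E> (bloch r) = (1/2) *\<^sub>m mat 1"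
  shows "\<E> = completely_depolarizing"
proof
  fix X :: "complex^2^2"
  interpret Vector_Spaces.linear mscale mscale \<E> by (fact lin)
  \<comment> \<open>Here \<open>a\<close>, \<open>b\<close>, \<open>c\<close> are the traces of
    \<open>X\<close> times the Pauli matrices. Each of the first three summands of the expansion
    also brings in a multiple of the identity; \<open>d\<close> corrects the total so that the four
    coefficients add up to the trace.\<close>
  define a where "a = (X $ 1 $ 2 + X $ 2 $ 1)"
  define b where "b = \<i> * (X $ 1 $ 2 - X $ 2 $ 1)"
  define c where "c = X $ 1 $ 1 - X $ 2 $ 2"
  define d where "d = X $ 1 $ 1 + X $ 2 $ 2 - a - b - c"
  have X: "X = a *\<^sub>m bloch (axis 1 1) + b *\<^sub>m bloch (axis 2 1) + c *\<^sub>m bloch (axis 3 1) + d *\<^sub>m bloch 0"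
    by (simp add: vec_eq_iff forall_2 mscale_def bloch_nth axis_def a_def b_def c_def d_def
        complex_eq_iff field_simps)
  have "\<E> X = a *\<^sub>m (1/2) *\<^sub>m mat 1 + b *\<^sub>m (1/2) *\<^sub>m mat 1 + c *\<^sub>m (1/2) *\<^sub>m mat 1 + d *\<^sub>m (1/2) *\<^sub>m mat 1"
    by (subst X) (simp add: add scale half)
  also have "\<dots> = completely_depolarizing X"
    by (simp add: vec_eq_iff mscale_def completely_depolarizing_def d_def trace_def sum_2 mat_def field_simps)
  finally show "\<E> X = completely_depolarizing X" .
qed

section \<open>The nullspace of \<open>T\<close> and the three cases\<close>

theorem theorem4p1:
  fixes \<E> :: "complex^2^2 \<Rightarrow> complex^2^2"
    and T :: "real^3^3"
    and S :: "(complex^2) set"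
  assumes "quantum_channel \<E>" and "unital \<E>"
    and "\<And>r :: real^3. norm r \<le> 1 \<Longrightarrow> \<E> (bloch r) = bloch (T *v r)"
    and "S = private_states \<E> ((1/2) *\<^sub>m mat 1)"
    and "S \<noteq> {}"
  shows "dim {r. T *v r = 0} \<in> {1, 2, 3} \<and>
    (dim {r. T *v r = 0} = 1 \<longrightarrow>
      (\<exists>\<phi> \<psi>. pure_state \<phi> \<and> pure_state \<psi> \<and> cinner \<phi> \<psi> = 0 \<and>
        S = {c *s \<phi> | c. cmod c = 1} \<union> {c *s \<psi> | c. cmod c = 1})) \<and>
    (dim {r. T *v r = 0} = 2 \<longrightarrow>
      (\<exists>U :: complex^2^2. unitary U \<and>
        S = {v. trace_vector {dagger U ** D ** U | D. D \<in> diagonal_matrices} v})) \<and>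
    (dim {r. T *v r = 0} = 3 \<longrightarrow>
      \<E> = completely_depolarizing \<and>
      S = {v. pure_state v} \<and>
      S = {v. trace_vector scalar_matrices v})"
proof -
  let ?N = "{r. T *v r = 0}"
  have sub: "subspace ?N"
    by (simp add: subspace_def matrix_vector_right_distrib matrix_vector_mult_scaleR)
  \<comment> \<open>The maximally mixed state is \<open>bloch 0\<close> and \<open>bloch\<close> is
    injective, so privacy of \<open>v\<close> says that \<open>T\<close> kills its Bloch
    vector.\<close>
  have S: "S = {v. pure_state v \<and> bloch_vector v \<in> ?N}"
  proof -
    have "\<E> (ketbra v) = (1/2) *\<^sub>m mat 1 \<longleftrightarrow> T *v bloch_vector v = 0" if "pure_state v" for v
      using that assms(3)[of "bloch_vector v"]
      by (simp add: ketbra_eq_bloch norm_bloch_vector pure_state_def bloch_eq_iff flip: bloch_0)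
    then show ?thesis by (auto simp: assms(4) private_states_def)
  qed
  obtain \<phi> where \<phi>: "pure_state \<phi>" "bloch_vector \<phi> \<in> ?N"
    using assms(5) S by auto
  have n\<phi>: "norm (bloch_vector \<phi>) = 1"
    using \<phi>(1) by (simp add: norm_bloch_vector pure_state_def)
  \<comment> \<open>Nonemptiness of \<open>S\<close> enters here: a private state yields a nonzero
    vector of the nullspace.\<close>
  have "dim ?N \<noteq> 0"
    using \<phi>(2) n\<phi> by (auto simp: dim_eq_0)
  moreover have "dim ?N \<le> 3"
    using dim_subset_UNIV[of ?N] by simp
  ultimately have "dim ?N \<in> {1, 2, 3}" unfolding insert_iff by linarith
  moreover have "\<exists>\<phi> \<psi>. pure_state \<phi> \<and> pure_state \<psi> \<and> cinner \<phi> \<psi> = 0 \<and>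
      S = {c *s \<phi> | c. cmod c = 1} \<union> {c *s \<psi> | c. cmod c = 1}" if "dim ?N = 1"
  proof -
    obtain \<psi> where \<psi>: "pure_state \<psi>" "bloch_vector \<psi> = - bloch_vector \<phi>"
      using bloch_vector_surj[of "- bloch_vector \<phi>"] n\<phi> by auto
    \<comment> \<open>The nullspace is the line through one private Bloch vector, and this line
      meets the unit sphere only in that vector and its antipode.\<close>
    have "span {bloch_vector \<phi>} = ?N"
    proof (rule subspace_dim_equal)
      have "dim {bloch_vector \<phi>} = 1"
        using n\<phi> by (subst dim_singleton) auto
      then show "dim ?N \<le> dim (span {bloch_vector \<phi>})" using that by simp
          show "span {bloch_vector \<phi>} \<subseteq> ?N" using sub \<phi>(2) by (intro span_minimal) auto
    qed (simp_all add: sub)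
    then have N: "?N = range (\<lambda>k. k *\<^sub>R bloch_vector \<phi>)"
      by (simp add: span_singleton)
    have "bloch_vector v \<in> ?N \<longleftrightarrow> bloch_vector v = bloch_vector \<phi> \<or> bloch_vector v = bloch_vector \<psi>"
      if "pure_state v" for v
    proof
      assume "bloch_vector v \<in> ?N"
      then obtain k where k: "bloch_vector v = k *\<^sub>R bloch_vector \<phi>" unfolding N by auto
      then have "\<bar>k\<bar> = 1"
        using n\<phi> norm_bloch_vector[of v] that by (simp add: pure_state_def)
      then show "bloch_vector v = bloch_vector \<phi> \<or> bloch_vector v = bloch_vector \<psi>"
        using k \<psi>(2) by (auto simp: abs_if split: if_splits)
    next
      assume "bloch_vector v = bloch_vector \<phi> \<or> bloch_vector v = bloch_vector \<psi>"
      then show "bloch_vector v \<in> ?N"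
        using \<phi>(2) \<psi>(2) sub subspace_neg by metis
    qed
    then have "S = {c *s \<phi> | c. cmod c = 1} \<union> {c *s \<psi> | c. cmod c = 1}"
      using \<phi>(1) \<psi>(1) unfolding S by (auto simp: bloch_vector_eq_iff pure_state_phase)
    with \<phi>(1) \<psi>(1) cinner_antipodal[OF \<phi>(1) \<psi>] show ?thesis by blast
  qed
  moreover have "\<exists>U :: complex^2^2. unitary U \<and>
      S = {v. trace_vector {dagger U ** D ** U | D. D \<in> diagonal_matrices} v}" if two: "dim ?N = 2"
  proof -
    \<comment> \<open>A two-dimensional nullspace is a plane with some normal \<open>a\<close>; its
      unit normal \<open>sgn a\<close> then serves as the axis of the great circle.\<close>
    have "dim ?N < DIM(real^3)" using two by simp
    from lowdim_subset_hyperplane[OF this]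
    obtain a where a: "a \<noteq> 0" "span ?N \<subseteq> {x. a \<bullet> x = 0}" by blast
    have "?N = {x. a \<bullet> x = 0}"
    proof (rule subspace_dim_equal)
      show "?N \<subseteq> {x. a \<bullet> x = 0}" using span_superset a(2) by (rule order_trans)
      show "dim {x. a \<bullet> x = 0} \<le> dim ?N" using a(1) two by (simp add: dim_hyperplane)
    qed (simp_all add: sub subspace_hyperplane)
    then have "S = {v. pure_state v \<and> sgn a \<bullet> bloch_vector v = 0}"
      using a(1) by (auto simp: S sgn_div_norm)
    moreover have "norm (sgn a) = 1" using a(1) by (simp add: norm_sgn)
    ultimately show ?thesis
      by (auto intro: trace_vectors_great_circle[of "sgn a"])
  qed
  moreover have "\<E> = completely_depolarizing \<and> S = {v. pure_state v} \<and>
      S = {v. trace_vector scalar_matrices v}" if "dim ?N = 3"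
  proof -
    have "span ?N = UNIV" using dim_eq_full[of ?N] that by simp
    then have N: "?N = UNIV" unfolding span_eq_iff[THEN iffD2, OF sub] .
    then have "T *v r = 0" for r by auto
    then have "\<E> (bloch r) = (1/2) *\<^sub>m mat 1" if "norm r \<le> 1" for r
      using assms(3)[OF that] by (simp add: bloch_0)
    then have "\<E> = completely_depolarizing"
      using assms(1) by (intro channel_eq_depolarizing) (simp_all add: quantum_channel_def)
    moreover have "S = {v. pure_state v}" using N by (auto simp: S)
    ultimately show ?thesis by (simp add: trace_vector_scalar_matrices)
  qed
  ultimately show ?thesis by blast
qed

end
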